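(* Let $\gamma_1\in\mathbb{R}$, let $\xi_1,\xi_2,\dots$ be independent random variables each uniformly distributed over $[2,3]$, define $\gamma_{j+1}:=\gamma_j+1+\xi_j$ for $j\in\mathbb{N}$, and set $S:=\bigcup_{j=1}^\infty[\gamma_j,\gamma_j+1]$. Then with probability one, no uniformly discrete set $\Lambda\subset\mathbb{R}$ is a uniqueness set for $W^{(\alpha)}_S$ (for $\alpha>1/2$).
   Context: Fourier transform: $\hat f(t)=\int e^{-2\pi i t x}f(x)\,dx$. For $\alpha>1/2$, $W^{(\alpha)}_S$ is the space of functions $f$ whose Fourier transform $F=\hat f$ satisfies $\int_{\mathbb{R}}(1+|t|^{2\alpha})|F(t)|^2\,dt<\infty$ and $F=0$ a.e. outside $S$ (such $f$ are continuous). A set $\Lambda$ is uniformly discrete if $\inf\{|\lambda-\lambda'|:\lambda\neq\lambda'\in\Lambda\}>0$. $\Lambda$ is a uniqueness set for a space of continuous functions if the only function in it vanishing on $\Lambda$ is zero. *)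

theory Defs
  imports "HOL-Probability.Probability"
begin

text \<open>Fourier convention: hat f(t) = integral of exp(-2 pi i t x) f(x) dx, so
  f is recovered from F = hat f by f(x) = integral of exp(2 pi i t x) F(t) dt.\<close>

definition inv_fourier :: "(real \<Rightarrow> complex) \<Rightarrow> real \<Rightarrow> complex" where
  "inv_fourier F x = (\<integral>t. cis (2 * pi * t * x) * F t \<partial>lborel)"

definition W_space :: "real \<Rightarrow> real set \<Rightarrow> (real \<Rightarrow> complex) set" where
  "W_space \<alpha> S = {f. \<exists>F. F \<in> borel_measurable lborel
      \<and> (\<integral>\<^sup>+ t. ennreal ((1 + \<bar>t\<bar> powr (2 * \<alpha>)) * (cmod (F t))\<^sup>2) \<partial>lborel) < \<infinity>
      \<and> (AE t in lborel. t \<notin> S \<longrightarrow> F t = 0)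
      \<and> f = inv_fourier F}"

definition uniformly_discrete :: "real set \<Rightarrow> bool" where
  "uniformly_discrete \<Lambda> \<longleftrightarrow> (\<exists>\<delta>>0. \<forall>x\<in>\<Lambda>. \<forall>y\<in>\<Lambda>. x \<noteq> y \<longrightarrow> \<delta> \<le> \<bar>x - y\<bar>)"

definition uniqueness_set :: "real set \<Rightarrow> (real \<Rightarrow> complex) set \<Rightarrow> bool" where
  "uniqueness_set \<Lambda> V \<longleftrightarrow> (\<forall>f\<in>V. (\<forall>x\<in>\<Lambda>. f x = 0) \<longrightarrow> f = (\<lambda>_. 0))"

text \<open>gam g1 xi 0 = gamma_1 and gam g1 xi (Suc j) = gamma_{j+2}; xi j is xi_{j+1}.\<close>

primrec gam :: "real \<Rightarrow> (nat \<Rightarrow> 'a \<Rightarrow> real) \<Rightarrow> 'a \<Rightarrow> nat \<Rightarrow> real" where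
  "gam g1 \<xi> \<omega> 0 = g1"
| "gam g1 \<xi> \<omega> (Suc j) = gam g1 \<xi> \<omega> j + 1 + \<xi> j \<omega>"

definition rand_set :: "real \<Rightarrow> (nat \<Rightarrow> 'a \<Rightarrow> real) \<Rightarrow> 'a \<Rightarrow> real set" where
  "rand_set g1 \<xi> \<omega> = (\<Union>j. {gam g1 \<xi> \<omega> j .. gam g1 \<xi> \<omega> j + 1})"

end

theory Submission
  imports Defs
begin

text \<open>Call \<open>P\<^sub>J(x)\<close> the exponential sum over the left endpoints \<open>\<gamma>\<^sub>j\<close>, \<open>j \<in> J\<close>. There is a finite pattern
  of admissible gaps, selecting some of the intervals, whose exponential sum is at most \<open>\<eta>\<close> times the
  number of its terms on \<open>\<delta> \<le> |x| \<le> R\<close>: passing from \<open>A\<close> to \<open>A \<union> (A + b)\<close> multiplies the sum by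
  \<open>1 + e(bx)\<close>, and of the two factors for \<open>b\<close> and \<open>2b + \<beta>\<close>, with \<open>\<beta>\<close> small, at least one is bounded
  away from 2. By independence, almost surely every such pattern occurs in the random sequence up to a
  small error, so \<open>|P\<^sub>J| \<le> \<eta> card J\<close> on \<open>\<delta> \<le> |x| \<le> R\<close> for a suitable finite \<open>J\<close>.

  Given a \<open>\<delta>\<close>-separated set with one extra point \<open>x\<^sub>0\<close> added, let \<open>K\<close> be the inverse transform of the
  average over \<open>J\<close> of translates of a fixed bump supported in \<open>[0,1]\<close>. Then \<open>K = P\<^sub>J/card J\<close> times a
  function with cubic decay, so \<open>K(0) = 1\<close> and \<open>|K(x)| \<le> \<kappa>/x\<^sup>2\<close> for \<open>|x| \<ge> \<delta>\<close> with \<open>\<kappa>\<close> as small as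
  desired. Hence the matrix \<open>K(\<lambda> - \<mu>)\<close> is a perturbation of the identity of norm at most 1/2 on
  \<open>\<ell>\<^sup>1\<close>, and some combination \<open>\<Sum> c\<^sub>\<mu> K(x - \<mu>)\<close> equals 1 at \<open>x\<^sub>0\<close> and vanishes on the given set.\<close>

section \<open>Gap patterns with small exponential sums\<close>

text \<open>The displacement of the left endpoint after \<open>k\<close> steps of the recursion for
  \<open>gam\<close>, if the random gaps took the values listed in \<open>g\<close>. It is
  meaningful for \<open>k \<le> length g\<close>.\<close>

definition gap_sum :: "real list \<Rightarrow> nat \<Rightarrow> real" where
  "gap_sum g k = (\<Sum>i<k. 1 + g ! i)"

text \<open>\<open>A\<close> selects left endpoints from a finite run of intervals starting at 0.
  Inclusion rather than equality allows intervals to be skipped, and the exact end \<open>T\<close>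
  of the run is recorded so that runs can be concatenated.\<close>

definition realizable :: "real set \<Rightarrow> real \<Rightarrow> bool" where
  "realizable A T \<longleftrightarrow> (\<exists>g. set g \<subseteq> {2..3} \<and> gap_sum g (length g) = T
      \<and> A \<subseteq> gap_sum g ` {..length g})"

lemma gap_sum_append_left: "k \<le> length g \<Longrightarrow> gap_sum (g @ h) k = gap_sum g k"
  unfolding gap_sum_def by (intro sum.cong) (auto simp: nth_append)

lemma gap_sum_append_right:
  "gap_sum (g @ h) (length g + k) = gap_sum g (length g) + gap_sum h k"
proof (induction k)
  case 0
  show ?case using gap_sum_append_left[of "length g" g h] by (simp add: gap_sum_def)
next
  case (Suc k)
  then show ?case by (simp add: gap_sum_def)
qed

lemma gap_sum_bounds:
  assumes "set g \<subseteq> {2..3}" "k \<le> length g"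
  shows "0 \<le> gap_sum g k" "gap_sum g k \<le> gap_sum g (length g)"
proof -
  have nn: "0 \<le> 1 + g ! i" if "i < length g" for i
    using assms(1) nth_mem[OF that] by force
  show "0 \<le> gap_sum g k"
    unfolding gap_sum_def using assms(2) by (intro sum_nonneg nn) auto
  show "gap_sum g k \<le> gap_sum g (length g)"
    unfolding gap_sum_def using assms(2) by (intro sum_mono2) (auto intro: nn)
qed

lemma realizable_subset_atLeastAtMost:
  assumes "realizable A T"
  shows "A \<subseteq> {0..T}"
proof -
  obtain g where g: "set g \<subseteq> {2..3}" "gap_sum g (length g) = T"
      "A \<subseteq> gap_sum g ` {..length g}"
    using assms unfolding realizable_def by blast
  have "gap_sum g k \<in> {0..T}" if "k \<le> length g" for k
    using gap_sum_bounds[OF g(1) that] unfolding g(2) by simp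
  then have "gap_sum g ` {..length g} \<subseteq> {0..T}" by auto
  with g(3) show ?thesis by (rule subset_trans)
qed

lemma realizable_singleton: "realizable {0} 0"
  unfolding realizable_def by (rule exI[of _ "[]"]) (auto simp: gap_sum_def)

text \<open>Equal steps work. With \<open>n\<close> the floor of \<open>r / 3\<close>, the step
  \<open>r / n\<close> is at least 3, and it is at most 4 because
  \<open>r < 3 * (n + 1) \<le> 4 * n\<close> once \<open>n \<ge> 3\<close>; this is where 9 comes
  from.\<close>

lemma gap_list_of_length:
  assumes "r \<ge> 9"
  shows "\<exists>h. set h \<subseteq> {2..3} \<and> gap_sum h (length h) = r"
proof -
  define n where "n = nat \<lfloor>r / 3\<rfloor>"
  have n: "real n \<le> r / 3" "r / 3 < real n + 1" "n \<ge> 3"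
    using assms unfolding n_def by linarith+
  have "set (replicate n (r / n - 1)) \<subseteq> {2..3}"
    using n by (auto simp: field_simps)
  moreover have "gap_sum (replicate n (r / n - 1)) n = r"
    using n by (simp add: gap_sum_def)
  ultimately show ?thesis
    by (intro exI[of _ "replicate n (r / n - 1)"]) simp
qed

text \<open>Two copies of the run \<open>g\<close> are joined by a connecting run \<open>h\<close>
  of length \<open>b - T \<ge> 9\<close>, so that the second copy starts exactly at
  \<open>b\<close>.\<close>

lemma realizable_double:
  assumes "realizable A T" "b \<ge> T + 9"
  shows "realizable (A \<union> (+) b ` A) (b + T)"
proof -
  obtain g where g: "set g \<subseteq> {2..3}" "gap_sum g (length g) = T"
      "A \<subseteq> gap_sum g ` {..length g}"
    using assms(1) unfolding realizable_def by blast
  obtain h where h: "set h \<subseteq> {2..3}" "gap_sum h (length h) = b - T"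
    using gap_list_of_length[of "b - T"] assms(2) by auto
  let ?l = "g @ h @ g"
  have shift: "gap_sum ?l (length g + (length h + k)) = b + gap_sum g k" for k
    using gap_sum_append_right[of g "h @ g" "length h + k"] gap_sum_append_right[of h g k]
    by (simp only: g(2) h(2) length_append)
  have 1: "a \<in> gap_sum ?l ` {..length ?l}" if "a \<in> A" for a
  proof -
    have "a \<in> gap_sum g ` {..length g}" using g(3) that by blast
    then obtain k where "k \<le> length g" "a = gap_sum g k" by auto
    then show ?thesis using gap_sum_append_left[of k g "h @ g"]
      by (intro image_eqI[of _ _ k]) auto
  qed
  have 2: "b + a \<in> gap_sum ?l ` {..length ?l}" if "a \<in> A" for a
  proof -
    have "a \<in> gap_sum g ` {..length g}" using g(3) that by blast
    then obtain k where "k \<le> length g" "a = gap_sum g k" by auto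
    then show ?thesis using shift[of k]
      by (intro image_eqI[of _ _ "length g + (length h + k)"]) auto
  qed
  have "gap_sum ?l (length ?l) = b + T"
    using shift[of "length g"] by (simp only: g(2) length_append)
  moreover have "set ?l \<subseteq> {2..3}" using g(1) h(1) by simp
  moreover have "A \<union> (+) b ` A \<subseteq> gap_sum ?l ` {..length ?l}" using 1 2 by blast
  ultimately show ?thesis
    unfolding realizable_def by blast
qed

section \<open>Exponential sums of patterns and their behaviour under doubling\<close>

definition exp_sum :: "real set \<Rightarrow> real \<Rightarrow> complex" where
  "exp_sum A x = (\<Sum>a\<in>A. cis (2 * pi * a * x))"

lemma exp_sum_double:
  assumes "realizable A T" "b > T" "finite A"
  shows "exp_sum (A \<union> (+) b ` A) x = exp_sum A x * (1 + cis (2 * pi * b * x))"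
    and "card (A \<union> (+) b ` A) = 2 * card A"
proof -
  have disj: "A \<inter> (+) b ` A = {}"
  proof safe
    fix a assume "a \<in> A" "b + a \<in> A"
    then have "0 \<le> a" "b + a \<le> T"
      using realizable_subset_atLeastAtMost[OF assms(1)] by auto
    then show "b + a \<in> {}" using assms(2) by simp
  qed
  have "(\<Sum>a\<in>(+) b ` A. cis (2 * pi * a * x)) = exp_sum A x * cis (2 * pi * b * x)"
    unfolding exp_sum_def
    by (subst sum.reindex) (auto simp: sum_distrib_right cis_mult intro!: sum.cong, simp add: algebra_simps)
  then show "exp_sum (A \<union> (+) b ` A) x = exp_sum A x * (1 + cis (2 * pi * b * x))"
    using disj assms(3) by (simp add: exp_sum_def sum.union_disjoint algebra_simps)
  show "card (A \<union> (+) b ` A) = 2 * card A"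
    using disj assms(3) by (subst card_Un_disjoint) (auto simp: card_image)
qed

lemma norm_one_plus_cis: "cmod (1 + cis (2 * u)) = 2 * \<bar>cos u\<bar>"
proof -
  have "(cmod (1 + cis (2 * u)))\<^sup>2 = 2 + 2 * cos (2 * u)"
    unfolding cmod_power2 using sin_cos_squared_add[of "2 * u"]
    by (simp add: power2_eq_square algebra_simps)
  also have "\<dots> = (2 * \<bar>cos u\<bar>)\<^sup>2"
    by (simp add: cos_double_cos power_mult_distrib)
  finally show ?thesis
    by (subst (asm) power2_eq_iff_nonneg) auto
qed

text \<open>Since \<open>\<bar>sin (v - 2 * u)\<bar>\<close> is at most
  \<open>\<bar>sin v\<bar> + 2 * \<bar>sin u\<bar>\<close>, the two sines cannot both lie below
  \<open>\<sigma> / 3\<close>; hence one of the cosines is bounded away from 1 in modulus.\<close>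

lemma abs_cos_mult_cos_le:
  assumes "0 \<le> \<sigma>" "\<sigma> \<le> \<bar>sin (v - 2 * u)\<bar>"
  shows "\<bar>cos u\<bar> * \<bar>cos v\<bar> \<le> sqrt (1 - (\<sigma> / 3)\<^sup>2)"
proof -
  have "\<bar>sin (v - 2 * u)\<bar> \<le> \<bar>sin v\<bar> * \<bar>cos (2 * u)\<bar> + \<bar>cos v\<bar> * \<bar>sin (2 * u)\<bar>"
    unfolding sin_diff by (metis abs_mult abs_triangle_ineq4)
  also have "\<dots> \<le> \<bar>sin v\<bar> * 1 + 1 * \<bar>sin (2 * u)\<bar>"
    by (intro add_mono mult_mono) auto
  also have "\<bar>sin (2 * u)\<bar> \<le> 2 * \<bar>sin u\<bar>"
    by (simp add: sin_double abs_mult mult_left_le)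
  finally have "\<sigma> / 3 \<le> \<bar>sin u\<bar> \<or> \<sigma> / 3 \<le> \<bar>sin v\<bar>"
    using assms by linarith
  then have "\<bar>cos u\<bar> \<le> sqrt (1 - (\<sigma> / 3)\<^sup>2) \<or> \<bar>cos v\<bar> \<le> sqrt (1 - (\<sigma> / 3)\<^sup>2)"
  proof -
    have *: "\<bar>cos w\<bar> \<le> sqrt (1 - (\<sigma> / 3)\<^sup>2)" if "\<sigma> / 3 \<le> \<bar>sin w\<bar>" for w
    proof -
      have "(\<sigma> / 3)\<^sup>2 \<le> (sin w)\<^sup>2"
        using that assms(1) by (metis abs_le_square_iff abs_of_nonneg divide_nonneg_nonneg zero_le_numeral)
      then have "(cos w)\<^sup>2 \<le> 1 - (\<sigma> / 3)\<^sup>2"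
        by (simp add: cos_squared_eq)
      then show ?thesis by (metis real_sqrt_abs real_sqrt_le_mono)
    qed
    then show ?thesis using \<open>\<sigma> / 3 \<le> \<bar>sin u\<bar> \<or> \<sigma> / 3 \<le> \<bar>sin v\<bar>\<close> by blast
  qed
  moreover have "\<bar>cos u\<bar> * \<bar>cos v\<bar> \<le> \<bar>cos u\<bar>" "\<bar>cos u\<bar> * \<bar>cos v\<bar> \<le> \<bar>cos v\<bar>"
    by (simp_all add: mult_left_le mult_left_le_one_le)
  ultimately show ?thesis by linarith
qed

text \<open>Each round of two doublings multiplies the ratio of the sum to the number of its terms
  by at most a fixed \<open>q < 1\<close>, uniformly on the range of \<open>x\<close>; iteration
  brings it below any \<open>\<eta>\<close>.\<close>

lemma realizable_small_exp_sum:
  fixes \<delta> R \<eta> :: real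
  assumes "0 < \<delta>" "0 < R" "0 < \<eta>"
  shows "\<exists>A T. realizable A T \<and> finite A \<and> A \<noteq> {} \<and>
           (\<forall>x. \<delta> \<le> \<bar>x\<bar> \<longrightarrow> \<bar>x\<bar> \<le> R \<longrightarrow> cmod (exp_sum A x) \<le> \<eta> * card A)"
proof (cases "\<delta> \<le> R")
  case False
  then show ?thesis
    by (intro exI[of _ "{0}"] exI[of _ 0]) (auto simp: realizable_singleton)
next
  case True
  \<comment> \<open>This choice keeps \<open>pi * \<beta> * \<bar>x\<bar>\<close> within the first
    quarter period for \<open>\<bar>x\<bar> \<le> R\<close>. There the sine is increasing, so its
    value \<open>\<sigma>\<close> at \<open>\<delta>\<close> is a lower bound on the whole
    range.\<close>
  define \<beta> where "\<beta> = 1 / (2 * R)"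
  define \<sigma> where "\<sigma> = sin (pi * \<beta> * \<delta>)"
  define q where "q = sqrt (1 - (\<sigma> / 3)\<^sup>2)"
  have \<beta>: "\<beta> > 0" using assms by (simp add: \<beta>_def)
  have range: "pi * \<beta> * \<delta> > 0" "pi * \<beta> * \<delta> \<le> pi / 2"
    using assms True by (auto simp: \<beta>_def field_simps)
  have \<sigma>: "\<sigma> > 0" unfolding \<sigma>_def using range pi_gt_zero by (intro sin_gt_zero) linarith+
  have "\<sigma> \<le> 1" by (simp add: \<sigma>_def)
  then have "(\<sigma> / 3)\<^sup>2 \<le> 1" using \<sigma> by (simp add: power_le_one)
  then have q: "0 \<le> q" "q < 1" using \<sigma> by (auto simp: q_def)
  have \<sigma>_le: "\<sigma> \<le> \<bar>sin (pi * \<beta> * x)\<bar>" if "\<delta> \<le> \<bar>x\<bar>" "\<bar>x\<bar> \<le> R" for x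
  proof -
    have "pi * \<beta> * \<delta> \<le> pi * \<beta> * \<bar>x\<bar>" using that \<beta> by (intro mult_left_mono) auto
    moreover have "pi * \<beta> * \<bar>x\<bar> \<le> pi / 2" using that assms by (auto simp: \<beta>_def field_simps)
    ultimately have "\<sigma> \<le> sin (pi * \<beta> * \<bar>x\<bar>)"
      unfolding \<sigma>_def using range by (intro sin_monotone_2pi_le) linarith+
    also have "\<dots> \<le> \<bar>sin (pi * \<beta> * x)\<bar>"
      by (cases "x \<ge> 0") auto
    finally show ?thesis .
  qed
  have "\<exists>A T. realizable A T \<and> finite A \<and> A \<noteq> {} \<and>
           (\<forall>x. \<delta> \<le> \<bar>x\<bar> \<longrightarrow> \<bar>x\<bar> \<le> R \<longrightarrow> cmod (exp_sum A x) \<le> q ^ n * card A)" for n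
  proof (induction n)
    case 0
    show ?case
      by (intro exI[of _ "{0}"] exI[of _ 0]) (auto simp: realizable_singleton exp_sum_def)
  next
    case (Suc n)
    then obtain A T where A: "realizable A T" "finite A" "A \<noteq> {}"
      and le: "\<And>x. \<delta> \<le> \<bar>x\<bar> \<Longrightarrow> \<bar>x\<bar> \<le> R \<Longrightarrow> cmod (exp_sum A x) \<le> q ^ n * card A"
      by blast
    \<comment> \<open>\<open>b\<close> is the smallest shift of \<open>A\<close> that
      \<open>realizable_double\<close> admits, and \<open>b'\<close> equals
      \<open>(b + T) + 9 + \<beta>\<close>, hence is admissible for \<open>B\<close>. The half
      phases \<open>u = pi * b * x\<close> and \<open>v = pi * b' * x\<close> satisfy
      \<open>v - 2 * u = pi * \<beta> * x\<close>, whatever \<open>T\<close> is.\<close>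
    define b where "b = T + 9"
    define b' where "b' = 2 * b + \<beta>"
    define B where "B = A \<union> (+) b ` A"
    define C where "C = B \<union> (+) b' ` B"
    have "T \<ge> 0" using realizable_subset_atLeastAtMost[OF A(1)] A(3) by fastforce
    have B: "realizable B (b + T)" unfolding B_def
      by (rule realizable_double[OF A(1)]) (simp add: b_def)
    have C: "realizable C (b' + (b + T))" unfolding C_def
      by (rule realizable_double[OF B]) (use \<beta> in \<open>simp add: b'_def b_def\<close>)
    have fin: "finite B" "finite C" "C \<noteq> {}" using A by (auto simp: B_def C_def)
    have b: "b > T" "b' > b + T" using \<beta> \<open>T \<ge> 0\<close> by (auto simp: b'_def b_def)
    have card: "real (card C) = 4 * card A"
      unfolding C_def exp_sum_double(2)[OF B b(2) fin(1)]
      unfolding B_def exp_sum_double(2)[OF A(1) b(1) A(2)] by simp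
    have "cmod (exp_sum C x) \<le> q ^ Suc n * card C" if x: "\<delta> \<le> \<bar>x\<bar>" "\<bar>x\<bar> \<le> R" for x
    proof -
      have "exp_sum C x = exp_sum A x * (1 + cis (2 * (pi * b * x))) * (1 + cis (2 * (pi * b' * x)))"
        unfolding C_def exp_sum_double(1)[OF B b(2) fin(1)]
        unfolding B_def exp_sum_double(1)[OF A(1) b(1) A(2)] by (simp add: mult_ac)
      then have "cmod (exp_sum C x) =
          4 * (cmod (exp_sum A x) * (\<bar>cos (pi * b * x)\<bar> * \<bar>cos (pi * b' * x)\<bar>))"
        by (simp add: norm_mult norm_one_plus_cis)
      also have "\<bar>cos (pi * b * x)\<bar> * \<bar>cos (pi * b' * x)\<bar> \<le> q"
        unfolding q_def
      proof (rule abs_cos_mult_cos_le)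
        have "pi * b' * x - 2 * (pi * b * x) = pi * \<beta> * x" by (simp add: b'_def algebra_simps)
        then show "\<sigma> \<le> \<bar>sin (pi * b' * x - 2 * (pi * b * x))\<bar>" using \<sigma>_le[OF x] by simp
      qed (use \<sigma> in simp)
      then have "4 * (cmod (exp_sum A x) * (\<bar>cos (pi * b * x)\<bar> * \<bar>cos (pi * b' * x)\<bar>))
          \<le> 4 * ((q ^ n * card A) * q)"
        using le[OF x] q by (intro mult_left_mono mult_mono) auto
      also have "\<dots> = q ^ Suc n * card C" using card by simp
      finally show ?thesis .
    qed
    with C fin show ?case by blast
  qed
  moreover obtain n where "q ^ n < \<eta>"
    using real_arch_pow_inv[of \<eta> q] assms q by blast
  ultimately obtain A T where "realizable A T" "finite A" "A \<noteq> {}"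
    and le: "\<And>x. \<delta> \<le> \<bar>x\<bar> \<Longrightarrow> \<bar>x\<bar> \<le> R \<Longrightarrow> cmod (exp_sum A x) \<le> q ^ n * card A"
    by meson
  moreover have "q ^ n * card A \<le> \<eta> * card A"
    using \<open>q ^ n < \<eta>\<close> by (intro mult_right_mono) auto
  ultimately show ?thesis by (meson order_trans)
qed

section \<open>Occurrence of patterns in the random sequence\<close>

text \<open>Even at an endpoint of the interval, the ball meets it in a segment of positive
  length.\<close>

lemma uniform_measure_ball_pos:
  fixes c \<epsilon> :: real
  assumes "c \<in> {2..3}" "\<epsilon> > 0"
  shows "measure (uniform_measure lborel {2..3}) (ball c \<epsilon>) > 0"
proof -
  define a b where "a = max 2 (c - \<epsilon> / 2)" and "b = min 3 (c + \<epsilon> / 2)"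
  have ab: "a < b" using assms by (auto simp: a_def b_def)
  have sub: "{a..b} \<subseteq> {2..3} \<inter> ball c \<epsilon>"
    using assms by (auto simp: a_def b_def dist_real_def)
  have fm: "{2..3} \<inter> ball c \<epsilon> \<in> fmeasurable lborel"
    by (rule fmeasurableI2[of "{2..3}"]) (auto intro: fmeasurableI)
  have "0 < measure lborel {a..b}" using ab by simp
  also have "\<dots> \<le> measure lborel ({2..3} \<inter> ball c \<epsilon>)"
    by (rule measure_mono_fmeasurable[OF sub _ fm]) auto
  finally show ?thesis
    by (subst measure_uniform_measure) auto
qed

text \<open>Disjoint blocks of consecutive indices give independent trials with the same success
  probability \<open>p > 0\<close>. The probability that all of them fail is at most
  \<open>(1 - p) ^ n\<close> for every \<open>n\<close>, hence zero.\<close>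

lemma (in prob_space) AE_exists_gap_pattern:
  fixes \<xi> :: "nat \<Rightarrow> 'a \<Rightarrow> real"
  assumes indep: "indep_vars (\<lambda>_. borel) \<xi> UNIV"
    and distr: "\<And>j. distr M lborel (\<xi> j) = uniform_measure lborel {2..3}"
    and g: "set g \<subseteq> {2..3}" and \<epsilon>: "\<epsilon> > 0"
  shows "AE \<omega> in M. \<exists>k. \<forall>i<length g. \<bar>\<xi> (k + i) \<omega> - g ! i\<bar> < \<epsilon>"
proof (cases "g = []")
  case True
  then show ?thesis by simp
next
  case False
  define m where "m = length g"
  have m: "m > 0" using False by (simp add: m_def)
  have rv[measurable]: "random_variable borel (\<xi> j)" for j
    using indep by (auto simp: indep_vars_def)
  define K where "K l = {l * m..<l * m + m}" for l
  have disj: "disjoint_family_on K UNIV"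
    unfolding disjoint_family_on_def
  proof (intro ballI impI)
    fix l l' :: nat assume "l \<noteq> l'"
    have "l = j div m" if "j \<in> K l" for j l
      using that m unfolding K_def
      by (metis atLeastLessThan_iff div_nat_eqI mult.commute mult_Suc_right add.commute)
    with \<open>l \<noteq> l'\<close> show "K l \<inter> K l' = {}" by blast
  qed
  define good where "good l = {\<omega> \<in> space M. \<forall>i<m. \<bar>\<xi> (l * m + i) \<omega> - g ! i\<bar> < \<epsilon>}" for l
  define E where "E l = {\<omega> \<in> space M. \<not> (\<forall>i<m. \<bar>\<xi> (l * m + i) \<omega> - g ! i\<bar> < \<epsilon>)}" for l
  have [measurable]: "good l \<in> events" "E l \<in> events" for l
    unfolding good_def E_def by measurable
  define p where "p = (\<Prod>i<m. measure (uniform_measure lborel {2..3}) (ball (g ! i) \<epsilon>))"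
  have "p > 0"
    unfolding p_def
  proof (intro prod_pos ballI uniform_measure_ball_pos \<epsilon>)
    fix i assume "i \<in> {..<m}"
    then show "g ! i \<in> {2..3}" using nth_mem[of i g] g by (auto simp only: m_def lessThan_iff)
  qed
  \<comment> \<open>Within a block independence turns the probability into a product, and the common
    distribution of the variables removes the dependence on \<open>l\<close>.\<close>
  have prob_good: "prob (good l) = p" for l
  proof -
    define B where "B j = ball (g ! (j - l * m)) \<epsilon>" for j
    have "good l = (\<Inter>j\<in>K l. \<xi> j -` B j \<inter> space M)"
    proof (intro equalityI subsetI)
      fix \<omega> assume \<omega>: "\<omega> \<in> good l"
      have "\<xi> j \<omega> \<in> B j" if "j \<in> K l" for j
      proof -
        from that obtain i where "j = l * m + i" "i < m"
          unfolding K_def by (metis atLeastLessThan_iff le_Suc_ex nat_add_left_cancel_less)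
        with \<omega> show ?thesis
          by (auto simp: good_def B_def dist_real_def abs_minus_commute)
      qed
      with \<omega> show "\<omega> \<in> (\<Inter>j\<in>K l. \<xi> j -` B j \<inter> space M)"
        by (auto simp: good_def)
    next
      fix \<omega> assume \<omega>: "\<omega> \<in> (\<Inter>j\<in>K l. \<xi> j -` B j \<inter> space M)"
      have "l * m + 0 \<in> K l" using m by (simp add: K_def)
      then have "\<omega> \<in> space M" using \<omega> by blast
      moreover have "\<bar>\<xi> (l * m + i) \<omega> - g ! i\<bar> < \<epsilon>" if "i < m" for i
      proof -
        have "l * m + i \<in> K l" using that by (simp add: K_def)
        then have "\<xi> (l * m + i) \<omega> \<in> B (l * m + i)" using \<omega> by blast
        then show ?thesis by (simp add: B_def dist_real_def abs_minus_commute)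
      qed
      ultimately show "\<omega> \<in> good l" by (simp add: good_def)
    qed
    also have "prob \<dots> = (\<Prod>j\<in>K l. prob (\<xi> j -` B j \<inter> space M))"
      using m by (intro indep_varsD[OF indep]) (auto simp: K_def B_def)
    also have "\<dots> = (\<Prod>j\<in>K l. measure (uniform_measure lborel {2..3}) (B j))"
    proof (rule prod.cong[OF refl])
      fix j
      have "measure (distr M lborel (\<xi> j)) (B j) = prob (\<xi> j -` B j \<inter> space M)"
        by (rule measure_distr) (auto simp: B_def)
      then show "prob (\<xi> j -` B j \<inter> space M) = measure (uniform_measure lborel {2..3}) (B j)"
        by (simp add: distr)
    qed
    also have "\<dots> = p"
      unfolding p_def
      by (rule prod.reindex_bij_witness[of _ "\<lambda>i. l * m + i" "\<lambda>j. j - l * m"])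
        (auto simp: K_def B_def)
    finally show ?thesis .
  qed
  have "E l = space M - good l" for l by (auto simp: E_def good_def)
  then have prob_E: "prob (E l) = 1 - p" for l
    using prob_compl[of "good l"] prob_good by simp
  \<comment> \<open>Grouping independent variables along disjoint index blocks gives independent
    random vectors. Each \<open>E l\<close> depends only on the vector of its own block.\<close>
  have "indep_vars (\<lambda>l. PiM (K l) (\<lambda>_. borel)) (\<lambda>l \<omega>. restrict (\<lambda>i. \<xi> i \<omega>) (K l)) UNIV"
    by (rule indep_vars_restrict[OF indep _ disj]) simp
  then have "indep_events (\<lambda>l. {\<omega> \<in> space M.
      \<not> (\<forall>i<m. \<bar>restrict (\<lambda>i. \<xi> i \<omega>) (K l) (l * m + i) - g ! i\<bar> < \<epsilon>)}) UNIV"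
  proof (rule indep_eventsI_indep_vars)
    fix l
    have [measurable]: "(\<lambda>f. f (l * m + i)) \<in> borel_measurable (PiM (K l) (\<lambda>_. borel :: real measure))"
      if "i < m" for i
      using that by (intro measurable_component_singleton) (simp add: K_def)
    show "{f \<in> space (PiM (K l) (\<lambda>_. borel)). \<not> (\<forall>i<m. \<bar>f (l * m + i) - g ! i\<bar> < \<epsilon>)}
        \<in> sets (PiM (K l) (\<lambda>_. borel))"
      by measurable
  qed
  also have "(\<lambda>l. {\<omega> \<in> space M.
      \<not> (\<forall>i<m. \<bar>restrict (\<lambda>i. \<xi> i \<omega>) (K l) (l * m + i) - g ! i\<bar> < \<epsilon>)}) = E"
    unfolding E_def K_def by (auto simp: fun_eq_iff)
  finally have indep_E: "indep_events E UNIV" .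
  have le: "prob (\<Inter>l. E l) \<le> (1 - p) ^ n" for n
  proof (cases "n = 0")
    case False
    have "prob (\<Inter>l. E l) \<le> prob (\<Inter>l<n. E l)"
      using False by (intro finite_measure_mono sets.finite_INT) auto
    also have "\<dots> = (\<Prod>l<n. prob (E l))"
      using indep_E False unfolding indep_events_def by (auto simp: lessThan_empty_iff)
    also have "\<dots> = (1 - p) ^ n" by (simp add: prob_E)
    finally show ?thesis .
  qed simp
  have "1 - p \<ge> 0" using prob_E[of 0] measure_nonneg[of M "E 0"] by simp
  then have "(\<lambda>n. (1 - p) ^ n) \<longlonglongrightarrow> 0"
    using \<open>p > 0\<close> by (intro LIMSEQ_power_zero) simp
  then have "prob (\<Inter>l. E l) \<le> 0"
    using le by (intro LIMSEQ_le_const) auto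
  then have "prob (\<Inter>l. E l) = 0"
    using measure_nonneg[of M "\<Inter>l. E l"] by linarith
  then have "AE \<omega> in M. \<omega> \<notin> (\<Inter>l. E l)"
    by (subst (asm) prob_eq_0) auto
  then show ?thesis
    using AE_space
  proof eventually_elim
    case (elim \<omega>)
    then obtain l where "\<forall>i<m. \<bar>\<xi> (l * m + i) \<omega> - g ! i\<bar> < \<epsilon>"
      by (auto simp: E_def)
    then show ?case unfolding m_def by blast
  qed
qed

section \<open>Transfer of small exponential sums from patterns to the random sequence\<close>

text \<open>A chord of the unit circle is no longer than its arc.\<close>

lemma cis_diff_le: "cmod (cis a - cis b) \<le> \<bar>a - b\<bar>"
proof -
  have "cis a - cis b = cis b * (exp (\<i> * of_real (a - b)) - 1)"
    by (simp add: cis_conv_exp flip: exp_add) (simp add: algebra_simps flip: exp_add)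
  then have "cmod (cis a - cis b) = 2 * \<bar>sin ((a - b) / 2)\<bar>"
    by (simp only: norm_mult norm_cis dist_exp_i_1)
  also have "\<dots> \<le> 2 * \<bar>(a - b) / 2\<bar>"
    by (intro mult_left_mono abs_sin_x_le_abs_x) auto
  finally show ?thesis by simp
qed

lemma gam_add: "gam g1 \<xi> \<omega> (k + n) = gam g1 \<xi> \<omega> k + (\<Sum>i<n. 1 + \<xi> (k + i) \<omega>)"
  by (induction n) auto

text \<open>The bound \<open>\<eta>\<close> is split in two halves: one for the ideal pattern, the
  other for the error made when the random gaps only approximate it. The position at which the
  pattern occurs contributes a common factor of modulus 1.\<close>

lemma (in prob_space) AE_small_exp_sum:
  fixes \<xi> :: "nat \<Rightarrow> 'a \<Rightarrow> real" and \<delta> R \<eta> :: real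
  assumes indep: "indep_vars (\<lambda>_. borel) \<xi> UNIV"
    and distr: "\<And>j. distr M lborel (\<xi> j) = uniform_measure lborel {2..3}"
    and pos: "0 < \<delta>" "0 < R" "0 < \<eta>"
  shows "AE \<omega> in M. \<exists>J. finite J \<and> J \<noteq> {} \<and> (\<forall>x. \<delta> \<le> \<bar>x\<bar> \<longrightarrow> \<bar>x\<bar> \<le> R \<longrightarrow>
           cmod (\<Sum>j\<in>J. cis (2 * pi * gam g1 \<xi> \<omega> j * x)) \<le> \<eta> * card J)"
proof -
  obtain A T where A: "realizable A T" "finite A" "A \<noteq> {}"
    and small: "\<And>x. \<delta> \<le> \<bar>x\<bar> \<Longrightarrow> \<bar>x\<bar> \<le> R \<Longrightarrow> cmod (exp_sum A x) \<le> \<eta> / 2 * card A"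
    using realizable_small_exp_sum[of \<delta> R "\<eta> / 2"] pos by (metis half_gt_zero)
  obtain g where g: "set g \<subseteq> {2..3}" "A \<subseteq> gap_sum g ` {..length g}"
    using A(1) unfolding realizable_def by blast
  have "\<forall>a\<in>A. \<exists>k. k \<le> length g \<and> gap_sum g k = a" using g(2) by fastforce
  then obtain \<kappa> where \<kappa>: "\<And>a. a \<in> A \<Longrightarrow> \<kappa> a \<le> length g \<and> gap_sum g (\<kappa> a) = a"
    by metis
  \<comment> \<open>Errors accumulate over at most \<open>length g\<close> gaps, so for
    \<open>\<bar>x\<bar> \<le> R\<close> each phase moves by at most
    \<open>2 * pi * R * (length g * \<epsilon>) \<le> \<eta> / 2\<close>. The summand 1 covers the
    empty pattern.\<close>
  define \<epsilon> where "\<epsilon> = \<eta> / (4 * pi * R * (length g + 1))"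
  have "\<epsilon> > 0" using pos by (simp add: \<epsilon>_def)
  have \<epsilon>_le: "2 * pi * R * (length g * \<epsilon>) \<le> \<eta> / 2"
  proof -
    have "2 * pi * R * (length g * \<epsilon>) = \<eta> / 2 * (length g / (length g + 1))"
      using pos by (simp add: \<epsilon>_def divide_simps)
    also have "\<dots> \<le> \<eta> / 2 * 1"
      using pos by (intro mult_left_mono) auto
    finally show ?thesis by simp
  qed
  show ?thesis
    using AE_exists_gap_pattern[OF indep distr g(1) \<open>\<epsilon> > 0\<close>]
  proof eventually_elim
    case (elim \<omega>)
    then obtain k where k: "\<And>i. i < length g \<Longrightarrow> \<bar>\<xi> (k + i) \<omega> - g ! i\<bar> < \<epsilon>" by blast
    let ?\<gamma> = "gam g1 \<xi> \<omega>"
    define J where "J = (\<lambda>a. k + \<kappa> a) ` A"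
    \<comment> \<open>The point \<open>a\<close> is recovered from its index
      \<open>\<kappa> a\<close> through \<open>gap_sum\<close>, so no terms of the sum
      merge.\<close>
    have inj: "inj_on (\<lambda>a. k + \<kappa> a) A"
      by (rule inj_onI) (metis \<kappa> add_left_cancel)
    have card: "card J = card A" unfolding J_def by (rule card_image[OF inj])
    have near: "\<bar>?\<gamma> (k + \<kappa> a) - (?\<gamma> k + a)\<bar> \<le> length g * \<epsilon>" if "a \<in> A" for a
    proof -
      have "?\<gamma> (k + \<kappa> a) - (?\<gamma> k + a) = (\<Sum>i<\<kappa> a. 1 + \<xi> (k + i) \<omega>) - gap_sum g (\<kappa> a)"
        using \<kappa>[OF that] by (simp add: gam_add)
      also have "\<dots> = (\<Sum>i<\<kappa> a. \<xi> (k + i) \<omega> - g ! i)"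
        unfolding gap_sum_def by (simp flip: sum_subtractf)
      also have "\<bar>\<dots>\<bar> \<le> (\<Sum>i<\<kappa> a. \<epsilon>)"
        using \<kappa>[OF that] by (intro order_trans[OF sum_abs] sum_mono less_imp_le k) auto
      also have "\<dots> \<le> length g * \<epsilon>"
        using \<kappa>[OF that] \<open>\<epsilon> > 0\<close> by (simp add: mult_right_mono)
      finally show ?thesis .
    qed
    have "cmod (\<Sum>j\<in>J. cis (2 * pi * ?\<gamma> j * x)) \<le> \<eta> * card J"
      if x: "\<delta> \<le> \<bar>x\<bar>" "\<bar>x\<bar> \<le> R" for x
    proof -
      let ?c = "cis (2 * pi * ?\<gamma> k * x)"
      have "(\<Sum>j\<in>J. cis (2 * pi * ?\<gamma> j * x)) = (\<Sum>a\<in>A. cis (2 * pi * ?\<gamma> (k + \<kappa> a) * x))"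
        unfolding J_def by (subst sum.reindex[OF inj]) simp
      also have "\<dots> = ?c * exp_sum A x +
          (\<Sum>a\<in>A. cis (2 * pi * ?\<gamma> (k + \<kappa> a) * x) - cis (2 * pi * (?\<gamma> k + a) * x))"
        by (simp add: exp_sum_def sum_subtractf sum_distrib_left cis_mult distrib_left distrib_right)
      finally have eq: "(\<Sum>j\<in>J. cis (2 * pi * ?\<gamma> j * x)) = \<dots>" .
      have "cmod (\<Sum>j\<in>J. cis (2 * pi * ?\<gamma> j * x)) \<le> cmod (?c * exp_sum A x) + (\<Sum>a\<in>A. 2 * pi * R * (length g * \<epsilon>))"
        unfolding eq
      proof (intro order_trans[OF norm_triangle_ineq] add_left_mono sum_norm_le)
        fix a assume "a \<in> A"
        have "cmod (cis (2 * pi * ?\<gamma> (k + \<kappa> a) * x) - cis (2 * pi * (?\<gamma> k + a) * x))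
            \<le> \<bar>2 * pi * ?\<gamma> (k + \<kappa> a) * x - 2 * pi * (?\<gamma> k + a) * x\<bar>"
          by (rule cis_diff_le)
        also have "\<dots> = 2 * pi * \<bar>x\<bar> * \<bar>?\<gamma> (k + \<kappa> a) - (?\<gamma> k + a)\<bar>"
          by (simp add: abs_mult flip: left_diff_distrib right_diff_distrib)
        also have "\<dots> \<le> 2 * pi * R * (length g * \<epsilon>)"
          using x near[OF \<open>a \<in> A\<close>] pos by (intro mult_mono) auto
        finally show "cmod (cis (2 * pi * ?\<gamma> (k + \<kappa> a) * x) - cis (2 * pi * (?\<gamma> k + a) * x))
            \<le> 2 * pi * R * (length g * \<epsilon>)" .
      qed
      also have "\<dots> \<le> \<eta> / 2 * card A + card A * (\<eta> / 2)"
      proof (rule add_mono)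
        show "cmod (?c * exp_sum A x) \<le> \<eta> / 2 * card A"
          using small[OF x] by (simp only: norm_mult norm_cis mult_1)
        show "(\<Sum>a\<in>A. 2 * pi * R * (length g * \<epsilon>)) \<le> card A * (\<eta> / 2)"
          unfolding sum_constant using \<epsilon>_le by (rule mult_left_mono) simp
      qed
      also have "\<dots> = \<eta> * card J" by (simp add: card)
      finally show ?thesis .
    qed
    then show ?case using A by (intro exI[of _ J]) (auto simp: J_def)
  qed
qed

section \<open>Neumann series in summable sequences\<close>

text \<open>Iterated sums are exchanged in the form \<open>infsum\<close>, whereas splitting off a
  first term and integrating termwise use \<open>suminf\<close>; absolute summability makes the two
  agree.\<close>

lemma infsum_eq_suminf:
  fixes f :: "nat \<Rightarrow> 'a :: banach"
  assumes "(\<lambda>n. norm (f n)) summable_on UNIV"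
  shows "summable (\<lambda>n. norm (f n))" "(\<Sum>\<^sub>\<infinity>n. f n) = (\<Sum>n. f n)"
proof -
  show s: "summable (\<lambda>n. norm (f n))"
    using assms by (rule summable_on_imp_summable)
  show "(\<Sum>\<^sub>\<infinity>n. f n) = (\<Sum>n. f n)"
    by (rule infsumI, rule norm_summable_imp_has_sum[OF s])
      (rule summable_sums[OF summable_norm_cancel[OF s]])
qed

text \<open>Column sums control the operator norm on absolutely summable sequences. It is at most
  1/2 here, so the identity plus \<open>A\<close> is inverted by the Neumann series.\<close>

lemma neumann_l1:
  fixes A :: "nat \<Rightarrow> nat \<Rightarrow> complex"
  assumes A: "\<And>j. (\<lambda>i. cmod (A i j)) summable_on UNIV"
    and col: "\<And>j. (\<Sum>\<^sub>\<infinity>i. cmod (A i j)) \<le> 1/2"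
    and u: "(\<lambda>i. cmod (u i)) summable_on UNIV"
  shows "\<exists>c. (\<lambda>i. cmod (c i)) summable_on UNIV \<and> (\<forall>i. c i + (\<Sum>\<^sub>\<infinity>j. A i j * c j) = u i)"
proof -
  \<comment> \<open>The sign is absorbed into \<open>T\<close>, so the solution is the sum of the
    iterates of \<open>T\<close> applied to \<open>u\<close>.\<close>
  define T where "T w = (\<lambda>i. - (\<Sum>\<^sub>\<infinity>j. A i j * w j))" for w
  \<comment> \<open>The inner sum runs over \<open>i\<close>, the row index, because only the column
    sums of \<open>A\<close> are controlled. Joint summability then allows the order of summation to
    be exchanged.\<close>
  have joint: "(\<lambda>x. cmod (case x of (j, i) \<Rightarrow> A i j * w j)) summable_on UNIV \<times> UNIV"
    if w: "(\<lambda>i. cmod (w i)) summable_on UNIV" for w :: "nat \<Rightarrow> complex"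
  proof (subst Infinite_Sum.abs_summable_on_Sigma_iff, intro conjI ballI)
    fix j
    show "(\<lambda>i. cmod (case (j, i) of (j, i) \<Rightarrow> A i j * w j)) summable_on UNIV"
      using summable_on_cmult_left[OF A[of j], of "cmod (w j)"] by (simp add: norm_mult)
  next
    have "(\<lambda>j. 1/2 * cmod (w j)) summable_on UNIV" by (intro summable_on_cmult_right w)
    then show "(\<lambda>j. norm (\<Sum>\<^sub>\<infinity>i. cmod (case (j, i) of (j, i) \<Rightarrow> A i j * w j))) summable_on UNIV"
    proof (rule Infinite_Sum.abs_summable_on_comparison_test')
      fix j
      show "norm (\<Sum>\<^sub>\<infinity>i. cmod (case (j, i) of (j, i) \<Rightarrow> A i j * w j)) \<le> 1/2 * cmod (w j)"
        using mult_right_mono[OF col[of j] norm_ge_zero[of "w j"]]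
        by (simp add: norm_mult infsum_cmult_left' infsum_nonneg)
    qed
  qed
  have T: "(\<lambda>i. cmod (T w i)) summable_on UNIV" "(\<Sum>\<^sub>\<infinity>i. cmod (T w i)) \<le> (\<Sum>\<^sub>\<infinity>j. cmod (w j)) / 2"
    if w: "(\<lambda>i. cmod (w i)) summable_on UNIV" for w :: "nat \<Rightarrow> complex"
  proof -
    have J: "(\<lambda>(i, j). cmod (A i j * w j)) summable_on UNIV \<times> UNIV"
      using joint[OF w] by (subst summable_on_swap) (simp add: case_prod_unfold)
    have rows: "(\<lambda>j. cmod (A i j * w j)) summable_on UNIV" for i
      using summable_on_SigmaD1[OF J, of i] by simp
    have le: "cmod (T w i) \<le> (\<Sum>\<^sub>\<infinity>j. cmod (A i j * w j))" for i
      unfolding T_def norm_minus_cancel using rows by (rule norm_infsum_bound)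
    have sum: "(\<lambda>i. \<Sum>\<^sub>\<infinity>j. cmod (A i j * w j)) summable_on UNIV"
      using summable_on_Sigma_banach[OF J] by simp
    show 1: "(\<lambda>i. cmod (T w i)) summable_on UNIV"
      by (rule Infinite_Sum.abs_summable_on_comparison_test'[OF sum]) (rule le)
    have "(\<Sum>\<^sub>\<infinity>i. cmod (T w i)) \<le> (\<Sum>\<^sub>\<infinity>i. \<Sum>\<^sub>\<infinity>j. cmod (A i j * w j))"
      by (rule infsum_mono[OF 1 sum]) (rule le)
    also have "\<dots> = (\<Sum>\<^sub>\<infinity>j. \<Sum>\<^sub>\<infinity>i. cmod (A i j * w j))"
      by (rule infsum_swap_banach) (use J in simp)
    also have "\<dots> = (\<Sum>\<^sub>\<infinity>j. (\<Sum>\<^sub>\<infinity>i. cmod (A i j)) * cmod (w j))"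
      by (simp add: norm_mult infsum_cmult_left')
    also have "\<dots> \<le> (\<Sum>\<^sub>\<infinity>j. 1/2 * cmod (w j))"
    proof (rule infsum_mono)
      show r: "(\<lambda>j. 1/2 * cmod (w j)) summable_on UNIV" by (intro summable_on_cmult_right w)
      show "(\<lambda>j. (\<Sum>\<^sub>\<infinity>i. cmod (A i j)) * cmod (w j)) summable_on UNIV"
        by (rule summable_on_comparison_test[OF r])
          (auto intro!: mult_right_mono mult_nonneg_nonneg infsum_nonneg simp del: times_divide_eq_left, use col in simp)
    qed (intro mult_right_mono col, simp)
    also have "\<dots> = (\<Sum>\<^sub>\<infinity>j. cmod (w j)) / 2"
      by (subst infsum_cmult_right') simp
    finally show "(\<Sum>\<^sub>\<infinity>i. cmod (T w i)) \<le> (\<Sum>\<^sub>\<infinity>j. cmod (w j)) / 2" .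
  qed
  define v where "v n = (T ^^ n) u" for n
  have v_Suc: "v (Suc n) = T (v n)" for n by (simp add: v_def)
  have v: "(\<lambda>i. cmod (v n i)) summable_on UNIV \<and> (\<Sum>\<^sub>\<infinity>i. cmod (v n i)) \<le> (\<Sum>\<^sub>\<infinity>i. cmod (u i)) * (1/2)^n" for n
  proof (induction n)
    case 0
    show ?case using u by (simp add: v_def)
  next
    case (Suc n)
    then show ?case using T[of "v n"] unfolding v_Suc by auto
  qed
  have geo: "(\<lambda>n. (\<Sum>\<^sub>\<infinity>i. cmod (u i)) * (1/2)^n) summable_on UNIV"
    by (intro summable_on_cmult_right norm_summable_imp_summable_on) (simp add: summable_geometric)
  have vv: "(\<lambda>x. cmod (case x of (n, i) \<Rightarrow> v n i)) summable_on UNIV \<times> UNIV"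
  proof (subst Infinite_Sum.abs_summable_on_Sigma_iff, intro conjI ballI)
    show "(\<lambda>n. norm (\<Sum>\<^sub>\<infinity>i. cmod (case (n, i) of (n, i) \<Rightarrow> v n i))) summable_on UNIV"
      by (rule Infinite_Sum.abs_summable_on_comparison_test'[OF geo]) (use v in \<open>simp add: infsum_nonneg\<close>)
  qed (use v in simp)
  have vv': "(\<lambda>(i, n). cmod (v n i)) summable_on UNIV \<times> UNIV"
    using vv by (subst summable_on_swap) (simp add: case_prod_unfold)
  have vn: "(\<lambda>n. cmod (v n i)) summable_on UNIV" for i
    using summable_on_SigmaD1[OF vv', of i] by simp
  define c where "c i = (\<Sum>\<^sub>\<infinity>n. v n i)" for i
  have c: "(\<lambda>i. cmod (c i)) summable_on UNIV"
  proof (rule Infinite_Sum.abs_summable_on_comparison_test')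
    show "(\<lambda>i. \<Sum>\<^sub>\<infinity>n. cmod (v n i)) summable_on UNIV"
      using summable_on_Sigma_banach[OF vv'] by simp
    show "cmod (c i) \<le> (\<Sum>\<^sub>\<infinity>n. cmod (v n i))" for i
      unfolding c_def by (rule norm_infsum_bound[OF vn])
  qed
  have "c i + (\<Sum>\<^sub>\<infinity>j. A i j * c j) = u i" for i
  proof -
    have bd: "cmod (A i j) \<le> 1" for j
    proof -
      have "(\<Sum>\<^sub>\<infinity>k\<in>{i}. cmod (A k j)) \<le> (\<Sum>\<^sub>\<infinity>k. cmod (A k j))"
        by (rule infsum_mono_neutral) (use A in auto)
      then show ?thesis using col[of j] by simp
    qed
    have "(\<lambda>(n, j). cmod (A i j * v n j)) summable_on UNIV \<times> UNIV"
      by (rule summable_on_comparison_test[OF vv])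
        (use bd in \<open>auto simp: norm_mult mult_left_le_one_le\<close>)
    then have "(\<lambda>x. cmod (case x of (n, j) \<Rightarrow> A i j * v n j)) summable_on UNIV \<times> UNIV"
      by (simp add: case_prod_unfold)
    then have dbl: "(\<lambda>(n, j). A i j * v n j) summable_on UNIV \<times> UNIV"
      by (rule abs_summable_summable)
    \<comment> \<open>Applying \<open>A\<close> to the series shifts it by one index and changes its
      sign; adding \<open>c i\<close> leaves only the initial term
      \<open>v 0 i = u i\<close>.\<close>
    have "(\<Sum>\<^sub>\<infinity>j. A i j * c j) = (\<Sum>\<^sub>\<infinity>j. \<Sum>\<^sub>\<infinity>n. A i j * v n j)"
      unfolding c_def by (simp add: infsum_cmult_right')
    also have "\<dots> = (\<Sum>\<^sub>\<infinity>n. \<Sum>\<^sub>\<infinity>j. A i j * v n j)"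
      by (rule infsum_swap_banach[symmetric]) (rule dbl)
    also have "\<dots> = - (\<Sum>\<^sub>\<infinity>n. v (Suc n) i)"
      unfolding v_Suc T_def by (subst infsum_uminus) simp
    finally have *: "(\<Sum>\<^sub>\<infinity>j. A i j * c j) = - (\<Sum>\<^sub>\<infinity>n. v (Suc n) i)" .
    note s = infsum_eq_suminf[OF vn[of i]]
    have "summable (\<lambda>n. norm (v (Suc n) i))" using s(1) by (subst summable_Suc_iff)
    then have s': "(\<lambda>n. norm (v (Suc n) i)) summable_on UNIV"
      by (intro norm_summable_imp_summable_on) simp
    have "c i = v 0 i + (\<Sum>n. v (Suc n) i)"
      unfolding c_def s(2) using suminf_split_head[OF summable_norm_cancel[OF s(1)]] by simp
    also have "(\<Sum>n. v (Suc n) i) = (\<Sum>\<^sub>\<infinity>n. v (Suc n) i)"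
      by (rule infsum_eq_suminf(2)[OF s', symmetric])
    finally show ?thesis using * by (simp add: v_def)
  qed
  with c show ?thesis by blast
qed

section \<open>Separated sequences\<close>

definition separated :: "real \<Rightarrow> (nat \<Rightarrow> real) \<Rightarrow> bool" where
  "separated \<delta> s \<longleftrightarrow> \<delta> > 0 \<and> (\<forall>i j. i \<noteq> j \<longrightarrow> \<delta> \<le> \<bar>s i - s j\<bar>)"

text \<open>The point \<open>s 0\<close> is the extra node at which the interpolating function takes the value 1.\<close>

lemma separated_enumeration:
  assumes "uniformly_discrete \<Lambda>"
  shows "\<exists>s \<delta>. separated \<delta> s \<and> \<Lambda> \<subseteq> range (\<lambda>n. s (Suc n))"
proof -
  \<comment> \<open>An enumeration by all natural numbers without repetition needs an infinite set.
    A finite set is enlarged by a progression of step 1 to its right, which only imposes more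
    zeros.\<close>
  have "\<exists>\<Lambda>'. uniformly_discrete \<Lambda>' \<and> infinite \<Lambda>' \<and> \<Lambda> \<subseteq> \<Lambda>'"
  proof (cases "finite \<Lambda>")
    case True
    then obtain b where b: "\<And>x. x \<in> \<Lambda> \<Longrightarrow> x \<le> b"
      using finite_imp_bounded[of \<Lambda>] bounded_real by (metis abs_le_D1)
    obtain \<delta> where \<delta>: "\<delta> > 0" "\<And>x y. x \<in> \<Lambda> \<Longrightarrow> y \<in> \<Lambda> \<Longrightarrow> x \<noteq> y \<Longrightarrow> \<delta> \<le> \<bar>x - y\<bar>"
      using assms unfolding uniformly_discrete_def by blast
    define N where "N = range (\<lambda>n::nat. b + 1 + real n)"
    have N: "b + 1 \<le> y" if "y \<in> N" for y using that by (auto simp: N_def)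
    have NN: "1 \<le> \<bar>x - y\<bar>" if "x \<in> N" "y \<in> N" "x \<noteq> y" for x y
      using that by (auto simp: N_def)
    have "min \<delta> 1 \<le> \<bar>x - y\<bar>" if xy: "x \<in> \<Lambda> \<union> N" "y \<in> \<Lambda> \<union> N" "x \<noteq> y" for x y
    proof -
      consider "x \<in> \<Lambda>" "y \<in> \<Lambda>" | "x \<in> N" "y \<in> N" | "x \<in> \<Lambda>" "y \<in> N" | "x \<in> N" "y \<in> \<Lambda>"
        using xy by blast
      then show ?thesis
        by cases (use \<delta>(2)[of x y] NN[of x y] N[of x] N[of y] b[of x] b[of y] xy(3) in linarith)+
    qed
    then have "uniformly_discrete (\<Lambda> \<union> N)"
      unfolding uniformly_discrete_def using \<delta>(1) by (intro exI[of _ "min \<delta> 1"]) auto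
    moreover have "infinite N"
      unfolding N_def by (rule range_inj_infinite) (auto simp: inj_on_def)
    ultimately show ?thesis by (intro exI[of _ "\<Lambda> \<union> N"]) auto
  qed (use assms in blast)
  then obtain \<Lambda>' \<delta> where L: "infinite \<Lambda>'" "\<Lambda> \<subseteq> \<Lambda>'" "\<delta> > 0"
    and sep: "\<And>x y. x \<in> \<Lambda>' \<Longrightarrow> y \<in> \<Lambda>' \<Longrightarrow> x \<noteq> y \<Longrightarrow> \<delta> \<le> \<bar>x - y\<bar>"
    unfolding uniformly_discrete_def by blast
  \<comment> \<open>This embeds the set into the integers and so gives countability.\<close>
  have "inj_on (\<lambda>x. \<lfloor>x / \<delta>\<rfloor>) \<Lambda>'"
  proof (rule inj_onI, rule ccontr)
    fix x y assume xy: "x \<in> \<Lambda>'" "y \<in> \<Lambda>'" "\<lfloor>x / \<delta>\<rfloor> = \<lfloor>y / \<delta>\<rfloor>" "x \<noteq> y"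
    then have "\<bar>x / \<delta> - y / \<delta>\<bar> < 1" by linarith
    then have "\<bar>x - y\<bar> < \<delta>" using L(3) by (simp add: field_simps flip: diff_divide_distrib)
    with sep[OF xy(1,2,4)] show False by simp
  qed
  then have "countable \<Lambda>'" by (rule countable_image_inj_on[rotated]) simp
  define e where "e = from_nat_into \<Lambda>'"
  have e: "bij_betw e UNIV \<Lambda>'"
    unfolding e_def by (rule bij_betw_from_nat_into[OF \<open>countable \<Lambda>'\<close> L(1)])
  have esep: "\<delta> \<le> \<bar>e i - e j\<bar>" if "i \<noteq> j" for i j
    using e that by (intro sep) (auto simp: bij_betw_def inj_on_def)
  \<comment> \<open>The extra node lies at distance \<open>\<delta> / 2\<close> from
    \<open>e 0\<close>. All other points are at least \<open>\<delta>\<close> away from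
    \<open>e 0\<close>, so separation \<open>\<delta> / 2\<close> survives.\<close>
  define s where "s n = (case n of 0 \<Rightarrow> e 0 + \<delta> / 2 | Suc k \<Rightarrow> e k)" for n
  have 0: "\<delta> / 2 \<le> \<bar>s 0 - s (Suc n)\<bar>" for n
  proof (cases "n = 0")
    case False
    with esep[of 0 n] have "\<delta> \<le> \<bar>e 0 - e n\<bar>" by simp
    then have "\<delta> / 2 \<le> \<bar>e 0 + \<delta> / 2 - e n\<bar>" using L(3) by linarith
    then show ?thesis by (simp add: s_def)
  qed (use L(3) in \<open>simp add: s_def\<close>)
  have "\<delta> / 2 \<le> \<bar>s i - s j\<bar>" if "i \<noteq> j" for i j
  proof (cases i; cases j)
    fix a b assume "i = Suc a" "j = Suc b"
    then show ?thesis using esep[of a b] that L(3) by (simp add: s_def)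
  next
    fix b assume "i = 0" "j = Suc b" then show ?thesis using 0[of b] by simp
  next
    fix b assume "i = Suc b" "j = 0" then show ?thesis using 0[of b] by (simp add: abs_minus_commute)
  qed (use that in simp)
  then have "separated (\<delta> / 2) s" using L(3) by (simp add: separated_def)
  moreover have "range (\<lambda>n. s (Suc n)) = \<Lambda>'" using e by (simp add: s_def bij_betw_def)
  ultimately show ?thesis using L(2) by blast
qed

text \<open>On either side of \<open>s j\<close>, the distances to it differ by the mutual distances
  of the points. Rounded down in units of \<open>\<delta>\<close> they become distinct positive
  integers, and the sum is compared with that of \<open>1 / n^2\<close>, uniformly in
  \<open>j\<close>.\<close>

lemma separated_sum_inverse_squares:
  assumes "separated \<delta> s"
  shows "\<exists>B>0. \<forall>j F. finite F \<longrightarrow> (\<Sum>i\<in>F - {j}. 1 / (s i - s j)\<^sup>2) \<le> B"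
proof -
  have \<delta>: "\<delta> > 0" and sep: "\<And>i j. i \<noteq> j \<Longrightarrow> \<delta> \<le> \<bar>s i - s j\<bar>"
    using assms by (auto simp: separated_def)
  \<comment> \<open>The term for \<open>n = 0\<close> is 0 by the convention for division by
    zero.\<close>
  define C where "C = (\<Sum>n. 1 / (real n)\<^sup>2)"
  have sm: "summable (\<lambda>n. 1 / (real n)\<^sup>2)"
    using inverse_power_summable[of 2, where ?'a = real] by (simp add: inverse_eq_divide power_one_over)
  have half: "(\<Sum>i\<in>G. 1 / (s i - s j)\<^sup>2) \<le> C / \<delta>\<^sup>2"
    if G: "finite G" "j \<notin> G" and side: "\<And>i. i \<in> G \<Longrightarrow> \<sigma> * (s i - s j) > 0" and \<sigma>: "\<bar>\<sigma>\<bar> = 1"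
    for G j and \<sigma> :: real
  proof -
    define m where "m i = nat \<lfloor>\<bar>s i - s j\<bar> / \<delta>\<rfloor>" for i
    have m: "real (m i) \<le> \<bar>s i - s j\<bar> / \<delta>" "\<bar>s i - s j\<bar> / \<delta> < real (m i) + 1" for i
      using \<delta> unfolding m_def by (auto simp: of_nat_nat)
    have m1: "m i \<ge> 1" if "i \<in> G" for i
    proof -
      have "1 \<le> \<bar>s i - s j\<bar> / \<delta>" using sep[of i j] G(2) that \<delta> by (auto simp: field_simps)
      then show ?thesis unfolding m_def by linarith
    qed
    have inj: "inj_on m G"
    proof (rule inj_onI, rule ccontr)
      fix a b assume ab: "a \<in> G" "b \<in> G" "m a = m b" "a \<noteq> b"
      have "\<bar>\<bar>s a - s j\<bar> / \<delta> - \<bar>s b - s j\<bar> / \<delta>\<bar> < 1"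
        using m[of a] m[of b] ab(3) by linarith
      then have "\<bar>\<bar>s a - s j\<bar> - \<bar>s b - s j\<bar>\<bar> < \<delta>"
        using \<delta> by (simp add: field_simps flip: diff_divide_distrib)
      moreover have "\<bar>\<bar>s a - s j\<bar> - \<bar>s b - s j\<bar>\<bar> = \<bar>s a - s b\<bar>"
        using side[OF ab(1)] side[OF ab(2)] \<sigma> by (auto simp: abs_if split: if_splits)
      ultimately show False using sep[OF ab(4)] by simp
    qed
    have "(\<Sum>i\<in>G. 1 / (s i - s j)\<^sup>2) \<le> (\<Sum>i\<in>G. 1 / (real (m i))\<^sup>2 / \<delta>\<^sup>2)"
    proof (rule sum_mono)
      fix i assume "i \<in> G"
      have "real (m i) * \<delta> \<le> \<bar>s i - s j\<bar>" using m(1)[of i] \<delta> by (simp add: field_simps)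
      then have "(real (m i) * \<delta>)\<^sup>2 \<le> (s i - s j)\<^sup>2"
        using \<delta> by (metis abs_le_square_iff abs_of_nonneg less_imp_le mult_nonneg_nonneg of_nat_0_le_iff)
      moreover have "0 < (real (m i) * \<delta>)\<^sup>2" using m1[OF \<open>i \<in> G\<close>] \<delta> by simp
      ultimately have "1 / (s i - s j)\<^sup>2 \<le> 1 / (real (m i) * \<delta>)\<^sup>2" by (simp add: frac_le)
      then show "1 / (s i - s j)\<^sup>2 \<le> 1 / (real (m i))\<^sup>2 / \<delta>\<^sup>2" by (simp add: power_mult_distrib)
    qed
    also have "\<dots> = (\<Sum>n\<in>m ` G. 1 / (real n)\<^sup>2) / \<delta>\<^sup>2"
      by (simp add: sum.reindex[OF inj] sum_divide_distrib)
    also have "\<dots> \<le> C / \<delta>\<^sup>2"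
      unfolding C_def using G(1) by (intro divide_right_mono sum_le_suminf sm) auto
    finally show ?thesis .
  qed
  have "(\<Sum>i\<in>F - {j}. 1 / (s i - s j)\<^sup>2) \<le> 2 * C / \<delta>\<^sup>2" if F: "finite F" for F j
  proof -
    define P where "P = {i \<in> F - {j}. s i > s j}"
    define N where "N = {i \<in> F - {j}. s i < s j}"
    have "s i \<noteq> s j" if "i \<noteq> j" for i using sep[OF that] \<delta> by auto
    then have "F - {j} = P \<union> N" by (auto simp: P_def N_def) (metis linorder_neqE_linordered_idom)
    moreover have "P \<inter> N = {}" "finite P" "finite N" using F by (auto simp: P_def N_def)
    ultimately have "(\<Sum>i\<in>F - {j}. 1 / (s i - s j)\<^sup>2) =
        (\<Sum>i\<in>P. 1 / (s i - s j)\<^sup>2) + (\<Sum>i\<in>N. 1 / (s i - s j)\<^sup>2)"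
      by (simp add: sum.union_disjoint)
    also have "\<dots> \<le> C / \<delta>\<^sup>2 + C / \<delta>\<^sup>2"
      using half[of P j 1] half[of N j "-1"] F by (intro add_mono) (auto simp: P_def N_def)
    finally show ?thesis by simp
  qed
  moreover have "C \<ge> 0" unfolding C_def by (intro suminf_nonneg sm) simp
  \<comment> \<open>The added 1 makes the bound strictly positive, so that it can be divided by
    later.\<close>
  then have "2 * C / \<delta>\<^sup>2 < 2 * C / \<delta>\<^sup>2 + 1" "0 < 2 * C / \<delta>\<^sup>2 + 1"
    using \<delta> by (auto intro!: add_nonneg_pos)
  ultimately show ?thesis by (meson less_imp_le order_trans)
qed

text \<open>The matrix with entries \<open>K (s i - s j)\<close> has unit diagonal, and its
  off-diagonal columns sum to at most \<open>\<kappa> * B \<le> 1/2\<close> in modulus. The Neumann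
  series therefore solves the system whose right-hand side is the unit vector at index 0.\<close>

lemma exists_inverse_of_dominant_kernel:
  fixes K :: "real \<Rightarrow> complex"
  assumes s: "separated \<delta> s" and K0: "K 0 = 1"
    and B: "\<And>j F. finite F \<Longrightarrow> (\<Sum>i\<in>F - {j}. 1 / (s i - s j)\<^sup>2) \<le> B"
    and K: "\<And>x. \<delta> \<le> \<bar>x\<bar> \<Longrightarrow> cmod (K x) \<le> \<kappa> / x\<^sup>2" and \<kappa>: "0 \<le> \<kappa>" "\<kappa> * B \<le> 1/2"
  shows "\<exists>c. summable (\<lambda>j. cmod (c j)) \<and>
           (\<forall>i. (\<Sum>j. c j * K (s i - s j)) = (if i = 0 then 1 else 0))"
proof -
  define A where "A i j = (if i = j then 0 else K (s i - s j))" for i j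
  have fin: "(\<Sum>i\<in>F. cmod (A i j)) \<le> 1/2" if "finite F" for F j
  proof -
    have "(\<Sum>i\<in>F. cmod (A i j)) = (\<Sum>i\<in>F - {j}. cmod (A i j))"
      using that by (intro sum.mono_neutral_right) (auto simp: A_def)
    also have "\<dots> \<le> (\<Sum>i\<in>F - {j}. \<kappa> * (1 / (s i - s j)\<^sup>2))"
      using K s by (intro sum_mono) (auto simp: A_def separated_def)
    also have "\<dots> = \<kappa> * (\<Sum>i\<in>F - {j}. 1 / (s i - s j)\<^sup>2)"
      by (simp add: sum_distrib_left)
    also have "\<dots> \<le> \<kappa> * B" using B[OF that] \<kappa>(1) by (rule mult_left_mono)
    finally show ?thesis using \<kappa>(2) by simp
  qed
  have A: "(\<lambda>i. cmod (A i j)) summable_on UNIV" for j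
    by (rule nonneg_bdd_above_summable_on) (auto intro!: bdd_aboveI2 fin)
  have col: "(\<Sum>\<^sub>\<infinity>i. cmod (A i j)) \<le> 1/2" for j
    by (rule infsum_le_finite_sums[OF A fin])
  have bd: "cmod (A i j) \<le> 1/2" for i j using fin[of "{i}" j] by simp
  define u :: "nat \<Rightarrow> complex" where "u i = (if i = 0 then 1 else 0)" for i
  have u: "(\<lambda>i. cmod (u i)) summable_on UNIV"
    by (rule finite_nonzero_values_imp_summable_on) (simp add: u_def)
  obtain c where c: "(\<lambda>i. cmod (c i)) summable_on UNIV"
    and eq: "\<And>i. c i + (\<Sum>\<^sub>\<infinity>j. A i j * c j) = u i"
    using neumann_l1[of A u, OF A col u] by blast
  note cs = infsum_eq_suminf(1)[OF c]
  have "(\<Sum>j. c j * K (s i - s j)) = u i" for i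
  proof -
    have "(\<lambda>j. cmod (A i j * c j)) summable_on UNIV"
    proof (rule Infinite_Sum.abs_summable_on_comparison_test'[OF c])
      fix j
      show "cmod (A i j * c j) \<le> cmod (c j)"
        using mult_right_mono[OF bd[of i j] norm_ge_zero[of "c j"]] norm_ge_zero[of "c j"]
        unfolding norm_mult by linarith
    qed
    note Ac = infsum_eq_suminf[OF this]
    have "(\<lambda>j. if j = i then c j else 0) sums c i" by (rule sums_single)
    moreover have "(\<lambda>j. A i j * c j) sums (\<Sum>j. A i j * c j)"
      by (rule summable_sums[OF summable_norm_cancel[OF Ac(1)]])
    ultimately have "(\<lambda>j. (if j = i then c j else 0) + A i j * c j) sums (c i + (\<Sum>j. A i j * c j))"
      by (rule sums_add)
    moreover have "(\<lambda>j. (if j = i then c j else 0) + A i j * c j) = (\<lambda>j. c j * K (s i - s j))"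
      using K0 by (auto simp: A_def fun_eq_iff)
    ultimately show ?thesis using eq[of i] Ac(2) by (simp add: sums_iff)
  qed
  with cs show ?thesis unfolding u_def by blast
qed

section \<open>Interpolation by translates of a bump\<close>

text \<open>The density of the Beta(3,3) distribution: 30 normalises the integral to 1, and the
  double zeros at both ends produce cubic decay of the transform.\<close>

definition bump :: "real \<Rightarrow> real" where
  "bump t = indicator {0..1} t * (30 * t\<^sup>2 * (1 - t)\<^sup>2)"

definition bump_hat :: "real \<Rightarrow> complex" where
  "bump_hat = inv_fourier (\<lambda>t. of_real (bump t))"

lemma borel_measurable_bump [measurable]: "bump \<in> borel_measurable borel"
  unfolding bump_def by measurable

lemma bump_eq_0: "t \<notin> {0..1} \<Longrightarrow> bump t = 0"
  by (simp add: bump_def)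

lemma abs_bump_le: "\<bar>bump t\<bar> \<le> 30"
proof (cases "t \<in> {0..1}")
  case True
  then have "t\<^sup>2 * (1 - t)\<^sup>2 \<le> 1 * 1" by (intro mult_mono power_le_one) auto
  with True show ?thesis by (simp add: bump_def abs_mult)
qed (simp add: bump_eq_0)

lemma bump_hat_eq_integral:
  "bump_hat x = (\<integral>t. indicator {0..1} t *\<^sub>R (cis (2 * pi * t * x) * of_real (30 * t\<^sup>2 * (1 - t)\<^sup>2)) \<partial>lborel)"
  unfolding bump_hat_def inv_fourier_def
  by (intro Bochner_Integration.integral_cong) (auto simp: bump_def indicator_def)

lemma bump_hat_0: "bump_hat 0 = 1"
proof -
  let ?\<Phi> = "\<lambda>t::real. of_real (10 * t ^ 3 - 15 * t ^ 4 + 6 * t ^ 5) :: complex"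
  have "bump_hat 0 = ?\<Phi> 1 - ?\<Phi> 0"
    unfolding bump_hat_eq_integral
  proof (rule integral_FTC_Icc)
    fix t :: real
    have "((\<lambda>t. 10 * t ^ 3 - 15 * t ^ 4 + 6 * t ^ 5) has_real_derivative 30 * t\<^sup>2 * (1 - t)\<^sup>2) (at t within {0..1})"
      by (auto intro!: derivative_eq_intros simp: field_simps power2_eq_square power3_eq_cube power4_eq_xxxx)
    then show "(?\<Phi> has_vector_derivative cis (2 * pi * t * 0) * of_real (30 * t\<^sup>2 * (1 - t)\<^sup>2)) (at t within {0..1})"
      using has_vector_derivative_of_real
      unfolding has_real_derivative_iff_has_vector_derivative by fastforce
  qed (auto intro!: continuous_intros)
  then show ?thesis by simp
qed

text \<open>Decay one power better than the required \<open>1 / x^2\<close> leaves a spare factor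
  \<open>\<bar>x\<bar>\<close>, which handles large \<open>\<bar>x\<bar>\<close>, where the
  exponential sum is only bounded trivially.\<close>

lemma bump_hat_decay:
  assumes "\<delta> > 0" "\<delta> \<le> \<bar>x\<bar>"
  shows "cmod (bump_hat x) \<le> (120 + 720 / \<delta> + 1440 / \<delta>\<^sup>2) / \<bar>x\<bar> ^ 3"
proof -
  define w where "w = 2 * pi * x * \<i>"
  have w: "w \<noteq> 0" using assms by (auto simp: w_def)
  \<comment> \<open>the antiderivative obtained by integrating by parts five times; the polynomial and its first
    derivative vanish at both endpoints, hence the cubic decay\<close>
  define \<Phi> where "\<Phi> z = exp (w * z) * (30 * (z\<^sup>2 - 2 * z ^ 3 + z ^ 4) / w - 30 * (2 * z - 6 * z\<^sup>2 + 4 * z ^ 3) / w ^ 2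
      + 30 * (2 - 12 * z + 12 * z\<^sup>2) / w ^ 3 - 30 * (24 * z - 12) / w ^ 4 + 720 / w ^ 5)" for z
  have deriv: "(\<Phi> has_field_derivative exp (w * z) * (30 * z\<^sup>2 * (1 - z)\<^sup>2)) (at z)" for z
    unfolding \<Phi>_def using w
    by (auto intro!: derivative_eq_intros simp: field_simps)
       (simp add: eval_nat_numeral algebra_simps)
  have "bump_hat x = \<Phi> (of_real 1) - \<Phi> (of_real 0)"
    unfolding bump_hat_eq_integral
  proof (rule integral_FTC_Icc)
    fix t :: real
    have "cis (2 * pi * t * x) = exp (w * of_real t)"
      by (simp add: cis_conv_exp w_def mult_ac)
    then show "((\<lambda>t. \<Phi> (of_real t)) has_vector_derivative cis (2 * pi * t * x) * of_real (30 * t\<^sup>2 * (1 - t)\<^sup>2)) (at t within {0..1})"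
      using has_vector_derivative_real_field[OF deriv[of "of_real t"], of "{0..1}"]
      by (simp add: o_def)
  qed (auto intro!: continuous_intros)
  also have "\<dots> = exp w * (60 / w ^ 3 - 360 / w ^ 4 + 720 / w ^ 5) - (60 / w ^ 3 + 360 / w ^ 4 + 720 / w ^ 5)"
    by (simp add: \<Phi>_def)
  finally have eq: "bump_hat x = \<dots>" .
  have ew: "cmod (exp w) = 1" by (simp add: w_def)
  have "cmod (bump_hat x) \<le> cmod (60 / w ^ 3 - 360 / w ^ 4 + 720 / w ^ 5) + cmod (60 / w ^ 3 + 360 / w ^ 4 + 720 / w ^ 5)"
    unfolding eq by (rule order_trans[OF norm_triangle_ineq4]) (simp only: norm_mult ew mult_1 order_refl)
  also have "\<dots> \<le> (cmod (60 / w ^ 3) + cmod (360 / w ^ 4) + cmod (720 / w ^ 5)) +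
      (cmod (60 / w ^ 3) + cmod (360 / w ^ 4) + cmod (720 / w ^ 5))"
    by (intro add_mono order_trans[OF norm_triangle_ineq] order_trans[OF norm_triangle_ineq4] order_refl)
  also have "\<dots> = (120 + 720 / cmod w + 1440 / (cmod w)\<^sup>2) / cmod w ^ 3"
  proof -
    have *: "2 * (60 / r ^ 3 + 360 / r ^ 4 + 720 / r ^ 5) = (120 + 720 / r + 1440 / r\<^sup>2) / r ^ 3"
      if "r \<noteq> 0" for r :: real
      using that by (simp add: field_simps eval_nat_numeral)
    show ?thesis using *[of "cmod w"] w by (simp add: norm_divide norm_power)
  qed
  also have "\<dots> \<le> (120 + 720 / \<delta> + 1440 / \<delta>\<^sup>2) / \<bar>x\<bar> ^ 3"
  proof -
    \<comment> \<open>\<open>cmod w\<close> is \<open>2 * pi * \<bar>x\<bar>\<close>. It is bounded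
      below by \<open>\<bar>x\<bar>\<close> in the cubic factor and by \<open>\<delta>\<close> in
      the lower-order terms.\<close>
    have "1 * \<bar>x\<bar> \<le> 2 * pi * \<bar>x\<bar>" using pi_ge_two by (intro mult_right_mono) auto
    then have le: "\<bar>x\<bar> \<le> cmod w" by (simp add: w_def norm_mult)
    with assms have "\<delta> \<le> cmod w" by simp
    with le assms show ?thesis
      by (intro frac_le add_mono power_mono order_refl) auto
  qed
  finally show ?thesis .
qed

section \<open>Construction of a nonzero function vanishing on the given set\<close>

lemma integrable_bounded_support:
  fixes f :: "real \<Rightarrow> complex"
  assumes [measurable]: "f \<in> borel_measurable borel"
    and "\<And>t. cmod (f t) \<le> C" "\<And>t. t \<notin> {a..b} \<Longrightarrow> f t = 0"
  shows "integrable lborel f"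
proof (rule integrableI_bounded_set[of "{a..b}" _ _ C])
  show "emeasure lborel {a..b} < \<infinity>" by (simp add: emeasure_lborel_Icc_eq)
qed (use assms in auto)

lemma integral_cis_bump_shift:
  "(\<integral>t. cis (2 * pi * t * x) * of_real (bump (t - g)) \<partial>lborel) = cis (2 * pi * g * x) * bump_hat x"
proof -
  have "(\<integral>t. cis (2 * pi * t * x) * of_real (bump (t - g)) \<partial>lborel) =
      (\<integral>t. cis (2 * pi * (g + 1 * t) * x) * of_real (bump (g + 1 * t - g)) \<partial>lborel)"
    by (subst lborel_integral_real_affine[where c = 1 and t = g]) auto
  also have "\<dots> = (\<integral>t. cis (2 * pi * g * x) * (cis (2 * pi * t * x) * of_real (bump t)) \<partial>lborel)"
    by (intro Bochner_Integration.integral_cong)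
      (auto simp: distrib_left distrib_right simp flip: cis_mult)
  also have "\<dots> = cis (2 * pi * g * x) * bump_hat x"
    by (simp add: bump_hat_def inv_fourier_def)
  finally show ?thesis .
qed

text \<open>The deterministic half of the argument. The witness has a bounded, compactly supported
  transform, so the weighted integral is finite; it vanishes on the enumerated set and equals 1 at
  the extra node.\<close>

lemma not_uniqueness_set_of_small_exp_sums:
  fixes \<gamma> :: "nat \<Rightarrow> real"
  assumes \<alpha>: "\<alpha> \<ge> 0"
    and small: "\<And>\<delta> R \<eta> :: real. 0 < \<delta> \<Longrightarrow> 0 < R \<Longrightarrow> 0 < \<eta> \<Longrightarrow>
      \<exists>J. finite J \<and> J \<noteq> {} \<and> (\<forall>x. \<delta> \<le> \<bar>x\<bar> \<longrightarrow> \<bar>x\<bar> \<le> R \<longrightarrow>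
           cmod (\<Sum>j\<in>J. cis (2 * pi * \<gamma> j * x)) \<le> \<eta> * card J)"
    and ud: "uniformly_discrete \<Lambda>"
  shows "\<not> uniqueness_set \<Lambda> (W_space \<alpha> (\<Union>j. {\<gamma> j..\<gamma> j + 1}))"
proof -
  obtain s \<delta> where sep: "separated \<delta> s" and sub: "\<Lambda> \<subseteq> range (\<lambda>n. s (Suc n))"
    using separated_enumeration[OF ud] by blast
  have \<delta>: "\<delta> > 0" using sep by (simp add: separated_def)
  obtain B where B: "B > 0" "\<And>j F. finite F \<Longrightarrow> (\<Sum>i\<in>F - {j}. 1 / (s i - s j)\<^sup>2) \<le> B"
    using separated_sum_inverse_squares[OF sep] by blast
  define \<kappa> where "\<kappa> = 1 / (2 * B)"
  have \<kappa>: "\<kappa> > 0" "\<kappa> * B \<le> 1/2" using B(1) by (auto simp: \<kappa>_def)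
  define D where "D = 120 + 720 / \<delta> + 1440 / \<delta>\<^sup>2"
  have D: "D > 0" using \<delta> by (auto simp: D_def intro!: add_pos_pos)
  \<comment> \<open>Both constants are chosen to give
    \<open>cmod (P x) \<le> \<kappa> * \<bar>x\<bar> / D\<close>: for
    \<open>\<bar>x\<bar> \<le> R\<close> from the bound \<open>\<eta>\<close>, beyond
    \<open>R\<close> from the trivial bound 1. Multiplying by \<open>D / \<bar>x\<bar> ^ 3\<close>
    yields exactly \<open>\<kappa> / x^2\<close>.\<close>
  define R where "R = D / \<kappa>"
  define \<eta> where "\<eta> = \<kappa> * \<delta> / D"
  have "R > 0" "\<eta> > 0" using D \<kappa> \<delta> by (auto simp: R_def \<eta>_def)
  then obtain J where J: "finite J" "J \<noteq> {}"
    and Jsmall: "\<And>x. \<delta> \<le> \<bar>x\<bar> \<Longrightarrow> \<bar>x\<bar> \<le> R \<Longrightarrow> cmod (\<Sum>j\<in>J. cis (2 * pi * \<gamma> j * x)) \<le> \<eta> * card J"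
    using small[OF \<delta>, of R \<eta>] by blast
  have cJ: "card J > 0" using J by (simp add: card_gt_0_iff)
  define P where "P x = (\<Sum>j\<in>J. cis (2 * pi * \<gamma> j * x)) / card J" for x
  define K where "K x = bump_hat x * P x" for x
  have P_le1: "cmod (P x) \<le> 1" for x
  proof -
    have "cmod (\<Sum>j\<in>J. cis (2 * pi * \<gamma> j * x)) \<le> (\<Sum>j\<in>J. 1)"
      by (rule sum_norm_le) simp
    then show ?thesis using cJ by (simp add: P_def norm_divide)
  qed
  have K_le: "cmod (K x) \<le> \<kappa> / x\<^sup>2" if x: "\<delta> \<le> \<bar>x\<bar>" for x
  proof -
    have x0: "\<bar>x\<bar> > 0" using x \<delta> by linarith
    have "cmod (P x) \<le> \<kappa> * \<bar>x\<bar> / D"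
    proof (cases "\<bar>x\<bar> \<le> R")
      case True
      have "cmod (P x) \<le> \<eta>" using Jsmall[OF x True] cJ by (simp add: P_def norm_divide field_simps)
      also have "\<dots> \<le> \<kappa> * \<bar>x\<bar> / D"
        unfolding \<eta>_def using x \<kappa> D by (intro divide_right_mono mult_left_mono) auto
      finally show ?thesis .
    next
      case False
      then have "1 \<le> \<kappa> * \<bar>x\<bar> / D" using \<kappa> D by (simp add: R_def field_simps)
      with P_le1[of x] show ?thesis by simp
    qed
    then have "cmod (K x) \<le> (D / \<bar>x\<bar> ^ 3) * (\<kappa> * \<bar>x\<bar> / D)"
      unfolding K_def norm_mult D_def using \<delta> x
      by (intro mult_mono bump_hat_decay) auto
    also have "\<dots> = \<kappa> / \<bar>x\<bar>\<^sup>2" using D x0 by (simp add: field_simps eval_nat_numeral)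
    finally show ?thesis by simp
  qed
  have K0: "K 0 = 1" using cJ by (simp add: K_def P_def bump_hat_0)
  obtain c where c: "summable (\<lambda>j. cmod (c j))"
    and eq: "\<And>i. (\<Sum>j. c j * K (s i - s j)) = (if i = 0 then 1 else 0)"
    using exists_inverse_of_dominant_kernel[of \<delta> s K B \<kappa>, OF sep K0 B(2) K_le] \<kappa> by auto
  define H where "H t = (\<Sum>j\<in>J. bump (t - \<gamma> j)) / card J" for t
  \<comment> \<open>Multiplying \<open>H\<close> by the phase with frequency \<open>- s j\<close>
    translates its inverse transform \<open>K\<close> by \<open>s j\<close>, so \<open>F\<close> is
    the transform of the combination of the \<open>K (x - s j)\<close> with coefficients
    \<open>c j\<close>.\<close>
  define F where "F t = of_real (H t) * (\<Sum>j. c j * cis (- (2 * pi * t * s j)))" for t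
  have [measurable]: "H \<in> borel_measurable borel" unfolding H_def by measurable
  have [measurable]: "(\<lambda>t. cis (- (2 * pi * t * a))) \<in> borel_measurable borel" for a
    by (intro borel_measurable_continuous_onI continuous_intros)
  have [measurable]: "(\<lambda>t. cis (2 * pi * t * a)) \<in> borel_measurable borel" for a
    by (intro borel_measurable_continuous_onI continuous_intros)
  have F_meas [measurable]: "F \<in> borel_measurable borel" unfolding F_def by measurable
  have H_le: "\<bar>H t\<bar> \<le> 30" for t
  proof -
    have "\<bar>\<Sum>j\<in>J. bump (t - \<gamma> j)\<bar> \<le> (\<Sum>j\<in>J. 30)"
      by (intro order_trans[OF sum_abs] sum_mono abs_bump_le)
    then show ?thesis using cJ by (simp add: H_def abs_divide field_simps)
  qed
  have H_supp: "H t = 0" if "t \<notin> (\<Union>j\<in>J. {\<gamma> j..\<gamma> j + 1})" for t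
    using that by (auto simp: H_def bump_eq_0 intro!: sum.neutral bump_eq_0)
  obtain L where L: "\<And>j. j \<in> J \<Longrightarrow> \<bar>\<gamma> j\<bar> \<le> L"
    using finite_imp_bounded[of "\<gamma> ` J"] J(1) by (auto simp: bounded_real)
  have H_supp': "H t = 0" if "t \<notin> {- L..L + 1}" for t
    using that L by (intro H_supp) fastforce
  have sums_cis: "summable (\<lambda>j. cmod (c j * cis (- (2 * pi * t * s j))))" for t
    using c by (simp add: norm_mult)
  define M where "M = 30 * (\<Sum>j. cmod (c j))"
  have F_le: "cmod (F t) \<le> M" for t
  proof -
    have "cmod (\<Sum>j. c j * cis (- (2 * pi * t * s j))) \<le> (\<Sum>j. cmod (c j))"
      using summable_norm[OF sums_cis[of t]] by (simp add: norm_mult)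
    then show ?thesis unfolding F_def M_def norm_mult norm_of_real
      using H_le[of t] by (intro mult_mono) auto
  qed
  have F_supp: "F t = 0" if "t \<notin> {- L..L + 1}" for t using H_supp'[OF that] by (simp add: F_def)
  have H_hat: "(\<integral>t. cis (2 * pi * t * x) * of_real (H t) \<partial>lborel) = K x" for x
  proof -
    have int: "integrable lborel (\<lambda>t. cis (2 * pi * t * x) * of_real (bump (t - \<gamma> j)))" for j
      using abs_bump_le
      by (intro integrable_bounded_support[where C = 30 and a = "\<gamma> j" and b = "\<gamma> j + 1"])
        (auto simp: norm_mult bump_eq_0)
    have "(\<integral>t. cis (2 * pi * t * x) * of_real (H t) \<partial>lborel) =
        (\<integral>t. (\<Sum>j\<in>J. cis (2 * pi * t * x) * of_real (bump (t - \<gamma> j))) / card J \<partial>lborel)"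
      by (intro Bochner_Integration.integral_cong) (auto simp: H_def sum_distrib_left)
    also have "\<dots> = (\<Sum>j\<in>J. cis (2 * pi * \<gamma> j * x) * bump_hat x) / card J"
      using int by (simp add: integral_cis_bump_shift)
    also have "\<dots> = K x" by (simp add: K_def P_def sum_distrib_left mult.commute)
    finally show ?thesis .
  qed
  define f where "f = inv_fourier F"
  have f_eq: "f x = (\<Sum>j. c j * K (x - s j))" for x
  proof -
    define \<phi> where "\<phi> j t = c j * (cis (2 * pi * t * (x - s j)) * of_real (H t))" for j t
    have [measurable]: "\<phi> j \<in> borel_measurable borel" for j unfolding \<phi>_def by measurable
    have n\<phi>: "cmod (\<phi> j t) = cmod (c j) * \<bar>H t\<bar>" for j t
      by (simp add: \<phi>_def norm_mult)
    have int: "integrable lborel (\<phi> j)" for j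
    proof (rule integrable_bounded_support)
      show "cmod (\<phi> j t) \<le> cmod (c j) * 30" for t
        unfolding n\<phi> by (intro mult_left_mono H_le) simp
      show "\<phi> j t = 0" if "t \<notin> {- L..L + 1}" for t
        using H_supp'[OF that] by (simp add: \<phi>_def)
    qed measurable
    have split: "cis (2 * pi * t * x) * F t = (\<Sum>j. \<phi> j t)" for t
    proof -
      have "(\<Sum>j. \<phi> j t) = (\<Sum>j. (cis (2 * pi * t * x) * of_real (H t)) * (c j * cis (- (2 * pi * t * s j))))"
        unfolding \<phi>_def by (simp add: right_diff_distrib mult_ac cis_mult)
      also have "\<dots> = (cis (2 * pi * t * x) * of_real (H t)) * (\<Sum>j. c j * cis (- (2 * pi * t * s j)))"
        by (rule suminf_mult[OF summable_norm_cancel[OF sums_cis]])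
      finally show ?thesis by (simp add: F_def mult_ac)
    qed
    have "f x = (\<integral>t. (\<Sum>j. \<phi> j t) \<partial>lborel)"
      unfolding f_def inv_fourier_def split ..
    \<comment> \<open>Sum and integral commute because \<open>\<phi> j t\<close> has modulus
      \<open>cmod (c j) * \<bar>H t\<bar>\<close>, with \<open>c\<close> absolutely summable and
      \<open>H\<close> integrable.\<close>
    also have "\<dots> = (\<Sum>j. integral\<^sup>L lborel (\<phi> j))"
    proof (rule integral_suminf[OF int])
      show "AE t in lborel. summable (\<lambda>j. cmod (\<phi> j t))"
        unfolding n\<phi> using c by (intro AE_I2 summable_mult2)
      show "summable (\<lambda>j. \<integral>t. cmod (\<phi> j t) \<partial>lborel)"
        unfolding n\<phi> using c by (simp add: summable_mult2)
    qed
    also have "\<dots> = (\<Sum>j. c j * K (x - s j))"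
      unfolding \<phi>_def by (simp add: H_hat)
    finally show ?thesis .
  qed
  have "(\<integral>\<^sup>+ t. ennreal ((1 + \<bar>t\<bar> powr (2 * \<alpha>)) * (cmod (F t))\<^sup>2) \<partial>lborel) < \<infinity>"
  proof -
    define b where "b = max (- L) (L + 1)"
    have le: "(1 + \<bar>t\<bar> powr (2 * \<alpha>)) * (cmod (F t))\<^sup>2
        \<le> (1 + b powr (2 * \<alpha>)) * M\<^sup>2 * indicator {- L..L + 1} t" for t
    proof (cases "t \<in> {- L..L + 1}")
      case True
      then have "\<bar>t\<bar> powr (2 * \<alpha>) \<le> b powr (2 * \<alpha>)"
        using \<alpha> by (intro powr_mono2) (auto simp: b_def)
      with True show ?thesis using F_le[of t] by (auto intro!: mult_mono power_mono)
    qed (simp add: F_supp)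
    have "ennreal ((1 + \<bar>t\<bar> powr (2 * \<alpha>)) * (cmod (F t))\<^sup>2)
        \<le> ennreal ((1 + b powr (2 * \<alpha>)) * M\<^sup>2) * indicator {- L..L + 1} t" for t
      by (cases "t \<in> {- L..L + 1}") (use le[of t] in \<open>auto intro!: ennreal_leI simp: F_supp\<close>)
    then have "(\<integral>\<^sup>+ t. ennreal ((1 + \<bar>t\<bar> powr (2 * \<alpha>)) * (cmod (F t))\<^sup>2) \<partial>lborel)
        \<le> (\<integral>\<^sup>+ t. ennreal ((1 + b powr (2 * \<alpha>)) * M\<^sup>2) * indicator {- L..L + 1} t \<partial>lborel)"
      by (rule nn_integral_mono)
    also have "\<dots> < \<infinity>"
      by (simp add: nn_integral_cmult_indicator emeasure_lborel_Icc_eq ennreal_mult_less_top)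
    finally show ?thesis .
  qed
  moreover have "AE t in lborel. t \<notin> (\<Union>j. {\<gamma> j..\<gamma> j + 1}) \<longrightarrow> F t = 0"
    using H_supp by (intro AE_I2) (auto simp: F_def)
  ultimately have "f \<in> W_space \<alpha> (\<Union>j. {\<gamma> j..\<gamma> j + 1})"
    unfolding W_space_def f_def using F_meas by (intro CollectI exI[of _ F]) simp
  moreover have "f x = 0" if "x \<in> \<Lambda>" for x
    using that sub by (auto simp: f_eq eq)
  moreover have "f (s 0) = 1" by (simp add: f_eq eq)
  then have "f \<noteq> (\<lambda>_. 0)" by (metis zero_neq_one)
  ultimately show ?thesis unfolding uniqueness_set_def by blast
qed

section \<open>The almost sure statement, with one null set for all discrete sets\<close>

theorem theorem8:
  fixes M :: "'a measure" and \<xi> :: "nat \<Rightarrow> 'a \<Rightarrow> real" and g1 \<alpha> :: real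
  assumes "prob_space M"
    and "prob_space.indep_vars M (\<lambda>_. borel) \<xi> UNIV"
    and "\<And>j. distr M lborel (\<xi> j) = uniform_measure lborel {2..3}"
    and "\<alpha> > 1/2"
  shows "AE \<omega> in M. \<forall>\<Lambda>. uniformly_discrete \<Lambda> \<longrightarrow>
           \<not> uniqueness_set \<Lambda> (W_space \<alpha> (rand_set g1 \<xi> \<omega>))"
proof -
  interpret prob_space M by fact
  \<comment> \<open>The null set has to be independent of the discrete set, and hence of the
    parameters it determines. The bound is monotone in \<open>\<delta>\<close>, \<open>R\<close> and
    \<open>\<eta>\<close>, so countably many triples suffice.\<close>
  have "AE \<omega> in M. \<forall>n::nat. \<exists>J. finite J \<and> J \<noteq> {} \<and>
      (\<forall>x. 1 / (real n + 1) \<le> \<bar>x\<bar> \<longrightarrow> \<bar>x\<bar> \<le> real n + 1 \<longrightarrow>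
        cmod (\<Sum>j\<in>J. cis (2 * pi * gam g1 \<xi> \<omega> j * x)) \<le> 1 / (real n + 1) * card J)"
    unfolding AE_all_countable
    by (intro allI AE_small_exp_sum[OF assms(2,3)]) auto
  then show ?thesis
  proof eventually_elim
    case (elim \<omega>)
    have "\<exists>J. finite J \<and> J \<noteq> {} \<and> (\<forall>x. \<delta> \<le> \<bar>x\<bar> \<longrightarrow> \<bar>x\<bar> \<le> R \<longrightarrow>
        cmod (\<Sum>j\<in>J. cis (2 * pi * gam g1 \<xi> \<omega> j * x)) \<le> \<eta> * card J)"
      if pos: "0 < \<delta>" "0 < R" "0 < \<eta>" for \<delta> R \<eta> :: real
    proof -
      obtain n :: nat where n: "1 / \<delta> + R + 1 / \<eta> \<le> real n" using real_arch_simple by blast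
      have "1 / \<delta> \<le> real n + 1" "R \<le> real n + 1" "1 / \<eta> \<le> real n + 1"
        using n pos divide_pos_pos[of 1 \<delta>] divide_pos_pos[of 1 \<eta>] by linarith+
      then have le: "1 / (real n + 1) \<le> \<delta>" "R \<le> real n + 1" "1 / (real n + 1) \<le> \<eta>"
        using pos by (auto simp: field_simps)
      obtain J where J: "finite J" "J \<noteq> {}"
        and small: "\<And>x. 1 / (real n + 1) \<le> \<bar>x\<bar> \<Longrightarrow> \<bar>x\<bar> \<le> real n + 1 \<Longrightarrow>
          cmod (\<Sum>j\<in>J. cis (2 * pi * gam g1 \<xi> \<omega> j * x)) \<le> 1 / (real n + 1) * card J"
        using elim[rule_format, of n] by (elim exE conjE) (rule that, auto)
      have "cmod (\<Sum>j\<in>J. cis (2 * pi * gam g1 \<xi> \<omega> j * x)) \<le> \<eta> * card J"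
        if "\<delta> \<le> \<bar>x\<bar>" "\<bar>x\<bar> \<le> R" for x
        using that le by (intro order_trans[OF small] mult_right_mono) auto
      with J show ?thesis by blast
    qed
    then show ?case
      unfolding rand_set_def using assms(4)
      by (intro allI impI not_uniqueness_set_of_small_exp_sums) auto
  qed
qed

end
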